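(* Let $b\ge 2$ be an integer and let $x=0.a_1a_2a_3\cdots$ (base-$b$ expansion, digits $a_j\in\{0,1,\dots,b-1\}$) be normal to base $b$. Let $L$ and $N$ be integers with $N\ge 2$. Let $(n_i)_{i\ge1}$ be the increasing sequence of positive integers such that a positive integer $n$ equals $n_i$ for some $i$ if and only if \[ \sum_{j=1}^{n}a_j\equiv L\pmod N . \] Then the number $0.a_{n_1}a_{n_2}a_{n_3}\cdots$ is normal to base $b$.
   Context: For an integer base $b\ge 2$, a number with base-$b$ digit sequence $0.d_1d_2d_3\cdots$ ($d_j\in\{0,\dots,b-1\}$) is normal to base $b$ if for every $k\ge1$ and every finite string $[c_1,\dots,c_k]$ of base-$b$ digits, \[ \lim_{n\to\infty}\frac{\#\{0\le i\le n-1:\ d_{i+j}=c_j \text{ for } 1\le j\le k\}}{n}=\frac{1}{b^k}. \] *)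

theory Defs
  imports Complex_Main "HOL-Library.Infinite_Set" "HOL-Number_Theory.Cong"
begin

text \<open>Digit sequences are indexed from 1, as in \<open>0.d\<^sub>1d\<^sub>2d\<^sub>3\<dots>\<close>;
  the value at index 0 plays no role.\<close>

definition digit_seq :: "nat \<Rightarrow> (nat \<Rightarrow> nat) \<Rightarrow> bool" where
  "digit_seq b d \<longleftrightarrow> (\<forall>j\<ge>1. d j < b)"

definition number_of_digits :: "nat \<Rightarrow> (nat \<Rightarrow> nat) \<Rightarrow> real" where
  "number_of_digits b d = (\<Sum>j. real (d (Suc j)) / real b ^ Suc j)"

definition normal_digits :: "nat \<Rightarrow> (nat \<Rightarrow> nat) \<Rightarrow> bool" where
  "normal_digits b d \<longleftrightarrow>
     (\<forall>k\<ge>1. \<forall>c. (\<forall>j\<in>{1..k}. c j < b) \<longrightarrow>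
        (\<lambda>n. real (card {i. i < n \<and> (\<forall>j\<in>{1..k}. d (i + j) = c j)}) / real n)
          \<longlonglongrightarrow> 1 / real b ^ k)"

text \<open>A number may have two base-\<open>b\<close> expansions, but then both are eventually constant and
  neither has normal digits. So a normal number has exactly one expansion, and the existential
  quantifier involves no choice.\<close>

definition normal_to_base :: "nat \<Rightarrow> real \<Rightarrow> bool" where
  "normal_to_base b x \<longleftrightarrow>
     (\<exists>d. digit_seq b d \<and> x = number_of_digits b d \<and> normal_digits b d)"

definition selected :: "(nat \<Rightarrow> nat) \<Rightarrow> int \<Rightarrow> int \<Rightarrow> nat set" where
  "selected a L N = {n. n \<ge> 1 \<and> [(\<Sum>j=1..n. int (a j)) = L] (mod N)}"

text \<open>The \<open>i\<close>-th selected position for \<open>i \<ge> 1\<close>; \<open>enumerate\<close> counts from 0, and lists the set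
  in increasing order provided that it is infinite.\<close>

definition selected_index :: "(nat \<Rightarrow> nat) \<Rightarrow> int \<Rightarrow> int \<Rightarrow> nat \<Rightarrow> nat" where
  "selected_index a L N i = enumerate (selected a L N) (i - 1)"

end

theory Submission
  imports Defs "HOL-Analysis.Analysis"
begin

text \<open>
  Write \<open>S n\<close> for the prefix sums. For an \<open>N\<close>-th root of unity \<open>z \<noteq> 1\<close> and a word \<open>w\<close>, the
  correlations of \<open>z ^ S n\<close> times the indicator of \<open>w\<close> occurring after position \<open>n\<close> decay
  exponentially with the lag, because normality turns them into powers of the mean of \<open>z ^ x\<close> over
  the digits \<open>x\<close>, which has modulus less than 1. By van der Corput's inequality the sequence has
  mean 0, so Fourier inversion on the residues mod \<open>N\<close> shows that residues of \<open>S n\<close> and words are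
  jointly equidistributed.

  Although the selection of \<open>a\<^sub>n\<close> depends on \<open>a\<^sub>n\<close> itself, it becomes predictable when the
  expansion is read backwards from a selected position: whether the next digit is selected depends
  only on the digits already read. Hence at most a proportion \<open>1 / b ^ k\<close> of the words of length \<open>m\<close>
  begin, read backwards, with a given selected word of length \<open>k\<close>. Since the gaps between
  selected positions have mean \<open>N\<close>, few occurrences stretch over more than \<open>m\<close> positions, which bounds
  the upper frequency of every word of length \<open>k\<close> by \<open>1 / b ^ k\<close>. There are \<open>b ^ k\<close> such words
  and their frequencies add up to 1, so these bounds are attained.
\<close>

section \<open>Means of sequences\<close>

text \<open>Stated over normed fields so that real frequencies and complex exponential sums share
  one notion.\<close>

definition has_mean :: "(nat \<Rightarrow> 'a::real_normed_field) \<Rightarrow> 'a \<Rightarrow> bool" where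
  "has_mean u c \<longleftrightarrow> (\<lambda>n. (\<Sum>i<n. u i) / of_nat n) \<longlonglongrightarrow> c"

lemma has_mean_add:
  "has_mean u c \<Longrightarrow> has_mean v d \<Longrightarrow> has_mean (\<lambda>i. u i + v i) (c + d)"
  unfolding has_mean_def by (simp add: sum.distrib add_divide_distrib tendsto_add)

lemma has_mean_cmult: "has_mean u c \<Longrightarrow> has_mean (\<lambda>i. k * u i) (k * c)"
  unfolding has_mean_def
  by (drule tendsto_mult_left[of _ _ _ k]) (simp add: sum_distrib_left)

lemma has_mean_sum:
  assumes "finite A" "\<And>x. x \<in> A \<Longrightarrow> has_mean (u x) (c x)"
  shows "has_mean (\<lambda>i. \<Sum>x\<in>A. u x i) (\<Sum>x\<in>A. c x)"
  using assms
proof (induction A rule: finite_induct)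
  case empty
  then show ?case by (simp add: has_mean_def)
next
  case (insert x A)
  then show ?case by (simp add: has_mean_add)
qed

lemma has_mean_cnj: "has_mean u c \<Longrightarrow> has_mean (\<lambda>i. cnj (u i)) (cnj c)"
  unfolding has_mean_def by (drule tendsto_cnj) simp

text \<open>Differences at shift 1 telescope to a sum bounded by \<open>2 * B\<close>, which
  vanishes after division by \<open>n\<close>; larger shifts follow by induction.\<close>

lemma has_mean_shift_diff:
  fixes u :: "nat \<Rightarrow> 'a::real_normed_field"
  assumes "\<And>i. norm (u i) \<le> B"
  shows "has_mean (\<lambda>i. u (i + s) - u i) 0"
proof (induction s)
  case 0
  then show ?case by (simp add: has_mean_def)
next
  case (Suc s)
  have "has_mean (\<lambda>i. u (i + Suc s) - u (i + s)) 0"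
    unfolding has_mean_def
  proof (rule Lim_null_comparison)
    show "\<forall>\<^sub>F n in sequentially. norm ((\<Sum>i<n. u (i + Suc s) - u (i + s)) / of_nat n)
            \<le> (2 * B) / real n"
    proof (rule always_eventually, rule allI)
      fix n
      have "(\<Sum>i<n. u (i + Suc s) - u (i + s)) = u (n + s) - u s"
        using sum_lessThan_telescope[of "\<lambda>i. u (i + s)" n] by simp
      moreover have "norm (u (n + s) - u s) \<le> 2 * B"
        using assms[of "n + s"] assms[of s] norm_triangle_ineq4[of "u (n + s)" "u s"] by linarith
      ultimately show "norm ((\<Sum>i<n. u (i + Suc s) - u (i + s)) / of_nat n) \<le> (2 * B) / real n"
        by (simp add: norm_divide divide_right_mono)
    qed
    show "(\<lambda>n. (2 * B) / real n) \<longlonglongrightarrow> 0"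
      by (rule lim_const_over_n)
  qed
  from has_mean_add[OF this Suc] show ?case by simp
qed

lemma has_mean_shift:
  fixes u :: "nat \<Rightarrow> 'a::real_normed_field"
  assumes "has_mean u c" "\<And>i. norm (u i) \<le> B"
  shows "has_mean (\<lambda>i. u (i + s)) c"
proof -
  have "has_mean (\<lambda>i. u (i + s) - u i) 0"
    by (rule has_mean_shift_diff[OF assms(2)])
  from has_mean_add[OF assms(1) this] show ?thesis by simp
qed

text \<open>Cauchy-Schwarz, with the sum of squares written through \<open>g i * cnj (g i)\<close>
  so that a known mean of these products can be inserted.\<close>

lemma norm_sum_squared_le:
  fixes g :: "nat \<Rightarrow> complex"
  shows "(norm (\<Sum>i<n. g i))\<^sup>2 \<le> real n * norm (\<Sum>i<n. g i * cnj (g i))"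
proof -
  have "(norm (\<Sum>i<n. g i))\<^sup>2 \<le> (\<Sum>i<n. norm (g i))\<^sup>2"
    by (intro power_mono norm_sum) auto
  also have "\<dots> \<le> real n * (\<Sum>i<n. (norm (g i))\<^sup>2)"
    using sum_squared_le_sum_of_squares[of "\<lambda>i. norm (g i)" "{..<n}"] by (simp add: mult.commute)
  also have "(\<Sum>i<n. (norm (g i))\<^sup>2) = norm (\<Sum>i<n. g i * cnj (g i))"
  proof -
    have "(\<Sum>i<n. g i * cnj (g i)) = of_real (\<Sum>i<n. (norm (g i))\<^sup>2)"
      by (simp only: complex_norm_square of_real_sum)
    then have "norm (\<Sum>i<n. g i * cnj (g i)) = \<bar>\<Sum>i<n. (norm (g i))\<^sup>2\<bar>"
      by (simp only: norm_of_real)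
    then show ?thesis by (simp add: sum_nonneg)
  qed
  finally show ?thesis .
qed

text \<open>The van der Corput trick: average \<open>f\<close> over the shifts by \<open>0, q, \<dots>, (H - 1) q\<close> and apply
  Cauchy--Schwarz.\<close>

lemma has_mean_0_if_small_correlations:
  fixes f :: "nat \<Rightarrow> complex"
  assumes bound: "\<And>i. norm (f i) \<le> 1"
    and corr: "\<And>\<epsilon>. \<epsilon> > 0 \<Longrightarrow> \<exists>q. \<forall>d. \<exists>\<gamma>. norm \<gamma> \<le> (if d = 0 then 1 else \<epsilon>) \<and>
      has_mean (\<lambda>i. f (i + d * q) * cnj (f i)) \<gamma>"
  shows "has_mean f 0"
  unfolding has_mean_def
proof (rule tendstoI)
  fix e :: real
  assume e: "e > 0"
  \<comment> \<open>The bound \<open>2 * H^2 * \<epsilon>\<close> found below for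
    \<open>norm C\<close> is then half of \<open>(H * e / 2)^2\<close>.\<close>
  define \<epsilon> where "\<epsilon> = e\<^sup>2 / 16"
  have \<epsilon>: "\<epsilon> > 0" using e by (simp add: \<epsilon>_def)
  obtain q where q: "\<And>d. \<exists>\<gamma>. norm \<gamma> \<le> (if d = 0 then 1 else \<epsilon>) \<and>
      has_mean (\<lambda>i. f (i + d * q) * cnj (f i)) \<gamma>"
    using corr[OF \<epsilon>] by blast
  \<comment> \<open>The \<open>H\<close> diagonal pairs contribute up to 1 each; this choice makes
    their total at most \<open>H^2 * \<epsilon>\<close>.\<close>
  obtain H :: nat where H: "1 / \<epsilon> < real H" using reals_Archimedean2 by blast
  have Hpos: "H > 0" using H \<epsilon> by (metis divide_pos_pos gr0I less_asym of_nat_0 zero_less_one)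
  define g where "g i = (\<Sum>h<H. f (i + h * q))" for i
  have prod_bound: "norm (f i * cnj (f j)) \<le> 1" for i j
    using bound[of i] bound[of j] by (simp add: norm_mult mult_le_one)
  \<comment> \<open>Only the difference of the two shifts matters, since means of bounded sequences
    are shift invariant; pairs in the other order follow by conjugation.\<close>
  have lag: "\<exists>\<gamma>. norm \<gamma> \<le> (if h = h' then 1 else \<epsilon>) \<and>
      has_mean (\<lambda>i. f (i + h * q) * cnj (f (i + h' * q))) \<gamma>" if "h' \<le> h" for h h'
  proof -
    obtain \<gamma> where \<gamma>: "norm \<gamma> \<le> (if h - h' = 0 then 1 else \<epsilon>)"
      "has_mean (\<lambda>i. f (i + (h - h') * q) * cnj (f i)) \<gamma>"
      using q by blast
    have "has_mean (\<lambda>i. f (i + h' * q + (h - h') * q) * cnj (f (i + h' * q))) \<gamma>"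
      by (rule has_mean_shift[OF \<gamma>(2)]) (rule prod_bound)
    moreover have "i + h' * q + (h - h') * q = i + h * q" for i
      using that by (metis add.assoc add_mult_distrib le_add_diff_inverse)
    ultimately show ?thesis using \<gamma>(1) that by (intro exI[of _ \<gamma>]) auto
  qed
  have "\<exists>\<gamma>. norm \<gamma> \<le> (if h = h' then 1 else \<epsilon>) \<and>
      has_mean (\<lambda>i. f (i + h * q) * cnj (f (i + h' * q))) \<gamma>" for h h'
  proof (cases "h' \<le> h")
    case True
    then show ?thesis by (rule lag)
  next
    case False
    then obtain \<gamma> where \<gamma>: "norm \<gamma> \<le> (if h' = h then 1 else \<epsilon>)"
      "has_mean (\<lambda>i. f (i + h' * q) * cnj (f (i + h * q))) \<gamma>"
      using lag[of h h'] by auto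
    then show ?thesis
      using has_mean_cnj[OF \<gamma>(2)] by (intro exI[of _ "cnj \<gamma>"]) (auto simp: mult.commute)
  qed
  then obtain \<gamma> where \<gamma>: "\<And>h h'. norm (\<gamma> h h') \<le> (if h = h' then 1 else \<epsilon>)"
    "\<And>h h'. has_mean (\<lambda>i. f (i + h * q) * cnj (f (i + h' * q))) (\<gamma> h h')"
    by metis
  define C where "C = (\<Sum>h<H. \<Sum>h'<H. \<gamma> h h')"
  have "has_mean (\<lambda>i. \<Sum>h<H. \<Sum>h'<H. f (i + h * q) * cnj (f (i + h' * q))) C"
    unfolding C_def by (intro has_mean_sum \<gamma>(2)) auto
  then have gC: "has_mean (\<lambda>i. g i * cnj (g i)) C"
    by (simp add: g_def sum_product)
  have "norm C \<le> (\<Sum>h<H. \<Sum>h'<H. if h = h' then 1 else \<epsilon>)"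
    unfolding C_def by (intro order.trans[OF norm_sum] sum_mono \<gamma>(1))
  also have "\<dots> \<le> (\<Sum>h<H. \<Sum>h'<H. (if h = h' then 1 else 0) + \<epsilon>)"
    using \<epsilon> by (intro sum_mono) auto
  also have "\<dots> = real H + (real H)\<^sup>2 * \<epsilon>"
    by (simp add: sum.distrib power2_eq_square algebra_simps)
  also have "\<dots> \<le> 2 * (real H)\<^sup>2 * \<epsilon>"
  proof -
    have "1 \<le> real H * \<epsilon>" using H \<epsilon> by (simp add: field_simps)
    then have "real H * 1 \<le> real H * (real H * \<epsilon>)" by (intro mult_left_mono) auto
    then show ?thesis by (simp add: power2_eq_square mult_ac)
  qed
  also have "\<dots> < (real H * e / 2)\<^sup>2"
    using e Hpos by (simp add: \<epsilon>_def power2_eq_square)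
  finally have "norm C < (real H * e / 2)\<^sup>2" .
  moreover have "(\<lambda>n. norm ((\<Sum>i<n. g i * cnj (g i)) / of_nat n)) \<longlonglongrightarrow> norm C"
    using gC unfolding has_mean_def by (rule tendsto_norm)
  ultimately have ev1: "\<forall>\<^sub>F n in sequentially.
      norm ((\<Sum>i<n. g i * cnj (g i)) / of_nat n) < (real H * e / 2)\<^sup>2"
    by (simp add: order_tendstoD(2))
  \<comment> \<open>\<open>f i - g i / H\<close> averages the differences
    \<open>f i - f (i + h * q)\<close>, each of mean 0, so \<open>f\<close> may be replaced by
    \<open>g / H\<close>.\<close>
  have "has_mean (\<lambda>i. (-1 / of_nat H) * (\<Sum>h<H. f (i + h * q) - f i)) ((-1 / of_nat H) * (\<Sum>h<H. 0))"
    by (intro has_mean_cmult has_mean_sum has_mean_shift_diff[OF bound]) auto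
  moreover have "(-1 / of_nat H) * (\<Sum>h<H. f (i + h * q) - f i) = f i - g i / of_nat H" for i
    using Hpos by (simp add: g_def sum_subtractf field_simps)
  ultimately have "has_mean (\<lambda>i. f i - g i / of_nat H) 0" by simp
  then have ev2: "\<forall>\<^sub>F n in sequentially.
      norm ((\<Sum>i<n. f i - g i / of_nat H) / of_nat n) < e / 2"
    unfolding has_mean_def using e by (auto dest!: tendstoD[where e = "e / 2"] simp: dist_0_norm simp del: of_nat_sum)
  show "\<forall>\<^sub>F n in sequentially. dist ((\<Sum>i<n. f i) / of_nat n) 0 < e"
    using ev1 ev2 eventually_gt_at_top[of 0]
  proof eventually_elim
    case (elim n)
    have "(norm (\<Sum>i<n. g i))\<^sup>2 \<le> real n * norm (\<Sum>i<n. g i * cnj (g i))"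
      by (rule norm_sum_squared_le)
    also have "\<dots> < real n * (real n * (real H * e / 2)\<^sup>2)"
      using elim(1,3) by (intro mult_strict_left_mono) (auto simp: norm_divide field_simps)
    also have "\<dots> = (real n * (real H * e / 2))\<^sup>2" by (simp add: power2_eq_square)
    finally have "norm (\<Sum>i<n. g i) < real n * (real H * e / 2)"
      by (rule power_less_imp_less_base) (use e in simp)
    then have g: "norm ((\<Sum>i<n. g i) / of_nat H / of_nat n) < e / 2"
      using elim(3) Hpos by (simp only: norm_divide norm_of_nat) (simp add: field_simps)
    have "(\<Sum>i<n. f i) / of_nat n =
        (\<Sum>i<n. f i - g i / of_nat H) / of_nat n + (\<Sum>i<n. g i) / of_nat H / of_nat n"
      by (simp add: sum_subtractf sum_divide_distrib diff_divide_distrib)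
    also have "norm \<dots> < e / 2 + e / 2"
      using g elim(2) by (intro norm_add_less)
    finally show ?case by simp
  qed
qed

section \<open>Words and blocks\<close>

definition words :: "nat \<Rightarrow> nat \<Rightarrow> nat list set" where
  "words b k = {w. set w \<subseteq> {..<b} \<and> length w = k}"

text \<open>The block starts at index \<open>i + 1\<close>: it is the window counted at
  \<open>i\<close> in \<open>normal_digits\<close>, and it follows directly on the digits summed in
  the \<open>i\<close>-th prefix sum.\<close>

definition block :: "(nat \<Rightarrow> nat) \<Rightarrow> nat \<Rightarrow> nat \<Rightarrow> nat list" where
  "block d k i = map d [Suc i..<Suc (i + k)]"

lemma finite_words: "finite (words b k)"
  by (simp add: words_def finite_lists_length_eq)

lemma card_words: "card (words b k) = b ^ k"
  by (simp add: words_def card_lists_length_eq)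

lemma words_0: "words b 0 = {[]}"
  by (auto simp: words_def)

lemma words_Suc: "words b (Suc k) = (\<lambda>(x, w). x # w) ` ({..<b} \<times> words b k)"
  by (auto simp: words_def length_Suc_conv image_iff)

lemma sum_words_Suc:
  "(\<Sum>w\<in>words b (Suc k). F w) = (\<Sum>x<b. \<Sum>w\<in>words b k. F (x # w))"
proof -
  have "inj_on (\<lambda>(x, w). x # w) ({..<b} \<times> words b k)"
    by (auto simp: inj_on_def)
  then show ?thesis
    by (simp add: words_Suc sum.reindex sum.cartesian_product case_prod_unfold)
qed

text \<open>A power of the digit sum is a product over the letters, so the sum over words factors
  letter by letter.\<close>

lemma sum_words_power:
  fixes z :: "'a::comm_semiring_1"
  shows "(\<Sum>w\<in>words b k. z ^ sum_list w) = (\<Sum>x<b. z ^ x) ^ k"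
  by (induction k)
    (simp_all add: words_0 sum_words_Suc power_add flip: sum_distrib_left sum_distrib_right)

lemma length_block [simp]: "length (block d k i) = k"
  by (simp add: block_def)

lemma block_in_words: "digit_seq b d \<Longrightarrow> block d k i \<in> words b k"
  by (auto simp: block_def words_def digit_seq_def)

lemma block_add: "block d (k + m) i = block d k i @ block d m (i + k)"
  using upt_add_eq_append[of "Suc i" "Suc (i + k)" m]
  by (simp add: block_def add.assoc flip: map_append del: upt_Suc)

lemma block_eq_iff:
  "block d k i = map c [1..<Suc k] \<longleftrightarrow> (\<forall>j\<in>{1..k}. d (i + j) = c j)"
proof -
  have "block d k i = map (\<lambda>j. d (i + j)) [1..<Suc k]"
    by (rule nth_equalityI) (auto simp: block_def simp del: upt_Suc)
  then show ?thesis by (auto simp del: upt_Suc)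
qed

lemma card_eq_sum_of_bool: "of_nat (card {i. i < (n::nat) \<and> P i}) = (\<Sum>i<n. of_bool (P i))"
proof -
  have "{..<n} \<inter> {i. P i} = {i. i < n \<and> P i}" by auto
  then show ?thesis by simp
qed

text \<open>Passes from digit strings as functions on \<open>{1..k}\<close> to words, and from
  counts to means of indicators.\<close>

lemma normal_digits_iff:
  "normal_digits b d \<longleftrightarrow>
    (\<forall>k\<ge>1. \<forall>w\<in>words b k. has_mean (\<lambda>i. of_bool (block d k i = w)) (1 / real b ^ k))"
    (is "_ \<longleftrightarrow> ?R")
proof -
  have eq: "(\<lambda>n. real (card {i. i < n \<and> (\<forall>j\<in>{1..k}. d (i + j) = c j)}) / real n) \<longlonglongrightarrow> 1 / real b ^ k
      \<longleftrightarrow> has_mean (\<lambda>i. of_bool (block d k i = map c [1..<Suc k])) (1 / real b ^ k)" for k c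
    unfolding has_mean_def block_eq_iff card_eq_sum_of_bool ..
  show ?thesis
  proof
    assume L: "normal_digits b d"
    show ?R
    proof (intro allI impI ballI)
      fix k w assume k: "k \<ge> (1::nat)" and w: "w \<in> words b k"
      define c where "c j = w ! (j - 1)" for j
      have "map c [1..<Suc k] = w"
        using w by (intro nth_equalityI) (auto simp: c_def words_def simp del: upt_Suc)
      moreover have "\<forall>j\<in>{1..k}. c j < b"
        using w by (auto simp: c_def words_def subset_iff)
      ultimately show "has_mean (\<lambda>i. of_bool (block d k i = w)) (1 / real b ^ k)"
        using L k eq[of k c] unfolding normal_digits_def by simp
    qed
  next
    assume R: ?R
    show "normal_digits b d"
      unfolding normal_digits_def
    proof (intro allI impI)
      fix k c assume k: "k \<ge> (1::nat)" and c: "\<forall>j\<in>{1..k}. c j < b"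
      have "map c [1..<Suc k] \<in> words b k"
        using c by (auto simp: words_def simp del: upt_Suc)
      then show "(\<lambda>n. real (card {i. i < n \<and> (\<forall>j\<in>{1..k}. d (i + j) = c j)}) / real n)
          \<longlonglongrightarrow> 1 / real b ^ k"
        using R k eq by blast
    qed
  qed
qed

lemma has_mean_complex_of_real:
  "has_mean (\<lambda>i. complex_of_real (u i)) (of_real c) \<longleftrightarrow> has_mean u c"
proof -
  have "(\<Sum>i<n. complex_of_real (u i)) / of_nat n = of_real ((\<Sum>i<n. u i) / of_nat n)" for n
    by simp
  then show ?thesis unfolding has_mean_def by (simp only: tendsto_of_real_iff)
qed

text \<open>A function of the block is a linear combination of indicators of words, whose means
  normality provides. Normality speaks only of \<open>k \<ge> 1\<close>, so the constant case
  \<open>k = 0\<close> is separate.\<close>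

lemma has_mean_block:
  fixes F :: "nat list \<Rightarrow> complex"
  assumes "digit_seq b d" "normal_digits b d"
  shows "has_mean (\<lambda>i. F (block d k i)) ((\<Sum>w\<in>words b k. F w) / of_nat b ^ k)"
proof (cases "k = 0")
  case True
  have "(\<lambda>n. (\<Sum>i<n. F []) / of_nat n) \<longlonglongrightarrow> F []"
    by (rule tendsto_eventually, rule eventually_mono[OF eventually_gt_at_top[of 0]]) simp
  then show ?thesis using True by (simp add: words_0 block_def has_mean_def)
next
  case False
  have freq: "has_mean (\<lambda>i. of_bool (block d k i = w)) (1 / real b ^ k)" if "w \<in> words b k" for w
    using assms(2) that False by (simp add: normal_digits_iff)
  have "has_mean (\<lambda>i. F w * of_bool (block d k i = w)) (F w * (1 / of_nat b ^ k))"
    if "w \<in> words b k" for w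
  proof (rule has_mean_cmult)
    have "complex_of_real (of_bool P) = of_bool P" for P by (cases P) auto
    then show "has_mean (\<lambda>i. of_bool (block d k i = w)) (1 / of_nat b ^ k :: complex)"
      using freq[OF that, folded has_mean_complex_of_real] by simp
  qed
  then have "has_mean (\<lambda>i. \<Sum>w\<in>words b k. F w * of_bool (block d k i = w))
      (\<Sum>w\<in>words b k. F w * (1 / of_nat b ^ k))"
    by (intro has_mean_sum finite_words)
  moreover have "(\<Sum>w\<in>words b k. F w * of_bool (block d k i = w)) = F (block d k i)" for i
    using block_in_words[OF assms(1), of k i]
    by (simp add: of_bool_def if_distrib finite_words cong: if_cong)
  ultimately show ?thesis by (simp add: sum_divide_distrib)
qed

section \<open>Joint equidistribution of prefix sums and blocks\<close>

definition digit_sum :: "(nat \<Rightarrow> nat) \<Rightarrow> nat \<Rightarrow> nat" where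
  "digit_sum d n = (\<Sum>j=1..n. d j)"

lemma digit_sum_0 [simp]: "digit_sum d 0 = 0"
  and digit_sum_Suc [simp]: "digit_sum d (Suc n) = digit_sum d n + d (Suc n)"
  by (simp_all add: digit_sum_def)

lemma digit_sum_add: "digit_sum d (n + k) = digit_sum d n + sum_list (block d k n)"
  by (induction k) (simp_all add: block_def)

text \<open>The first two terms, 1 and \<open>z\<close>, are distinct unit vectors, so the triangle
  inequality is strict for them; every other term has modulus 1.\<close>

lemma norm_sum_powers_less:
  fixes z :: complex
  assumes "norm z = 1" "z \<noteq> 1" "b \<ge> 2"
  shows "norm (\<Sum>x<b. z ^ x) < real b"
proof -
  have ne: "norm (1 + z) < 2"
  proof -
    have "norm (1 + z) \<noteq> 2"
    proof
      assume "norm (1 + z) = 2"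
      then have "norm (1 + z) = norm (1::complex) + norm z" using assms by simp
      then have "z = 1" using assms(1) norm_triangle_eq[of 1 z] by simp
      then show False using assms by simp
    qed
    then show ?thesis using norm_triangle_ineq[of 1 z] assms(1) by simp
  qed
  obtain m where m: "b = Suc (Suc m)"
    using assms(3) by (metis add_2_eq_Suc le_Suc_ex)
  have "(\<Sum>x<b. z ^ x) = (1 + z) + (\<Sum>x<m. z ^ Suc (Suc x))"
    by (simp only: m sum.lessThan_Suc_shift) simp
  also have "norm \<dots> \<le> norm (1 + z) + (\<Sum>x<m. norm (z ^ Suc (Suc x)))"
    by (intro order.trans[OF norm_triangle_ineq] add_left_mono norm_sum)
  also have "\<dots> = norm (1 + z) + real m" using assms(1) by (simp add: norm_mult norm_power)
  finally show ?thesis using ne m by simp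
qed

text \<open>The contributing words are exactly \<open>w @ u @ w\<close> with \<open>u\<close> free
  of length \<open>m - k\<close>, so the sum over \<open>u\<close> factors into a power.\<close>

lemma correlation_sum:
  fixes z :: complex
  assumes "w \<in> words b k" "m \<ge> k"
  shows "(\<Sum>v\<in>words b (m + k). of_bool (take k v = w \<and> drop m v = w) * z ^ sum_list (take m v))
    = z ^ sum_list w * (\<Sum>x<b. z ^ x) ^ (m - k)" (is "?S = _")
proof -
  let ?A = "{v \<in> words b (m + k). take k v = w \<and> drop m v = w}"
  have "?S = (\<Sum>v\<in>?A. z ^ sum_list (take m v))"
    by (rule sum.mono_neutral_cong_right) (auto simp: finite_words)
  also have "\<dots> = (\<Sum>u\<in>words b (m - k). z ^ sum_list (w @ u))"
  proof (rule sum.reindex_bij_witness[where j = "\<lambda>v. drop k (take m v)" and i = "\<lambda>u. w @ u @ w"])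
    fix v assume v: "v \<in> ?A"
    have *: "w @ drop k (take m v) = take m v"
      using v assms(2) by (metis (mono_tags, lifting) append_take_drop_id mem_Collect_eq min.absorb1 take_take)
    show "w @ drop k (take m v) @ w = v"
      using v * by (metis (mono_tags, lifting) append_assoc append_take_drop_id mem_Collect_eq)
    show "drop k (take m v) \<in> words b (m - k)"
      using v by (auto simp: words_def dest: in_set_dropD in_set_takeD)
    show "z ^ sum_list (w @ drop k (take m v)) = z ^ sum_list (take m v)"
      by (simp only: *)
  next
    fix u assume "u \<in> words b (m - k)"
    then show "drop k (take m (w @ u @ w)) = u" "w @ u @ w \<in> ?A"
      using assms by (auto simp: words_def)
  qed
  also have "\<dots> = z ^ sum_list w * (\<Sum>x<b. z ^ x) ^ (m - k)"
    by (simp add: power_add sum_words_power flip: sum_distrib_left)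
  finally show ?thesis .
qed

text \<open>In a correlation at lag \<open>m\<close> the factor \<open>z ^ digit_sum d i\<close>
  cancels against its conjugate. What remains is a function of one block of length
  \<open>m + k\<close>, whose mean normality evaluates.\<close>

lemma has_mean_twisted_block:
  fixes z :: complex
  assumes d: "digit_seq b d" "normal_digits b d" and b: "b \<ge> 2"
    and w: "w \<in> words b k" and z: "norm z = 1" "z \<noteq> 1"
  shows "has_mean (\<lambda>i. z ^ digit_sum d i * of_bool (block d k i = w)) 0"
proof (rule has_mean_0_if_small_correlations)
  let ?f = "\<lambda>i. z ^ digit_sum d i * of_bool (block d k i = w)"
  fix \<epsilon> :: real assume \<epsilon>: "\<epsilon> > 0"
  define \<rho> where "\<rho> = norm (\<Sum>x<b. z ^ x) / real b"
  have \<rho>: "0 \<le> \<rho>" "\<rho> < 1"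
    using norm_sum_powers_less[OF z b] b by (simp_all add: \<rho>_def)
  obtain r where r: "\<rho> ^ r < \<epsilon>" using real_arch_pow_inv[OF \<epsilon> \<rho>(2)] by blast
  \<comment> \<open>Every nonzero multiple \<open>m\<close> of \<open>q\<close> has
    \<open>m - k \<ge> r\<close>: the two occurrences of \<open>w\<close> do not overlap, and at
    least \<open>r\<close> free letters lie between them.\<close>
  define q where "q = k + r"
  have zz: "z ^ n * cnj (z ^ n) = 1" for n
    using complex_norm_square[of "z ^ n"] z(1) by (simp add: norm_power)
  have "\<exists>\<gamma>. norm \<gamma> \<le> (if t = 0 then 1 else \<epsilon>) \<and>
      has_mean (\<lambda>i. ?f (i + t * q) * cnj (?f i)) \<gamma>" for t
  proof (cases "t = 0")
    case True
    have eq: "?f i * cnj (?f i) = of_bool (block d k i = w)" for i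
      using zz[of "digit_sum d i"] by simp
    have "has_mean (\<lambda>i. of_bool (block d k i = w))
        ((\<Sum>v\<in>words b k. of_bool (v = w)) / of_nat b ^ k :: complex)"
      by (rule has_mean_block[OF d])
    moreover have "(\<Sum>v\<in>words b k. of_bool (v = w)) = (1::complex)"
      using w by (simp add: of_bool_def finite_words)
    ultimately have "has_mean (\<lambda>i. ?f i * cnj (?f i)) (1 / of_nat b ^ k)"
      unfolding eq by simp
    moreover have "norm (1 / of_nat b ^ k :: complex) \<le> 1"
      using b by (simp add: norm_divide norm_power)
    ultimately show ?thesis using True by (intro exI[of _ "1 / of_nat b ^ k"]) simp
  next
    case False
    define m where "m = t * q"
    have m: "m \<ge> k + r" using False by (simp add: m_def q_def)
    let ?F = "\<lambda>v. of_bool (take k v = w \<and> drop m v = w) * z ^ sum_list (take m v)"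
    have "?f (i + m) * cnj (?f i) = ?F (block d (m + k) i)" for i
    proof -
      obtain l where l: "m = k + l" using m le_Suc_ex by (metis add.assoc)
      have "take k (block d (m + k) i) = block d k i"
        by (simp add: l block_add)
      moreover have "take m (block d (m + k) i) = block d m i"
        "drop m (block d (m + k) i) = block d k (i + m)"
        by (simp_all add: block_add)
      moreover have "z ^ digit_sum d (i + m) * cnj (z ^ digit_sum d i) = z ^ sum_list (block d m i)"
        using zz[of "digit_sum d i"] by (simp add: digit_sum_add power_add)
      ultimately show ?thesis by (simp add: of_bool_conj mult_ac)
    qed
    moreover have "has_mean (\<lambda>i. ?F (block d (m + k) i))
        ((\<Sum>v\<in>words b (m + k). ?F v) / of_nat b ^ (m + k))"
      by (rule has_mean_block[OF d])
    moreover have "norm ((\<Sum>v\<in>words b (m + k). ?F v) / of_nat b ^ (m + k)) \<le> \<epsilon>"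
    proof -
      have "norm ((\<Sum>v\<in>words b (m + k). ?F v) / of_nat b ^ (m + k))
          = norm (\<Sum>x<b. z ^ x) ^ (m - k) / real b ^ (m + k)"
        using m z(1) by (subst correlation_sum[OF w]) (simp_all add: norm_divide norm_mult norm_power)
      \<comment> \<open>Dropping the factor \<open>b ^ (2 * k)\<close> from the denominator leaves a
        pure power of \<open>\<rho>\<close>.\<close>
      also have "\<dots> \<le> norm (\<Sum>x<b. z ^ x) ^ (m - k) / real b ^ (m - k)"
        using b by (intro divide_left_mono power_increasing) auto
      also have "\<dots> = \<rho> ^ (m - k)" by (simp add: \<rho>_def power_divide)
      also have "\<dots> \<le> \<rho> ^ r" using m \<rho> by (intro power_decreasing) auto
      finally show ?thesis using r by simp
    qed
    ultimately show ?thesis using False by (auto simp: m_def)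
  qed
  then show "\<exists>q. \<forall>t. \<exists>\<gamma>. norm \<gamma> \<le> (if t = 0 then 1 else \<epsilon>) \<and>
      has_mean (\<lambda>i. ?f (i + t * q) * cnj (?f i)) \<gamma>" by blast
qed (simp add: z(1) norm_mult norm_power)

section \<open>Roots of unity and residues modulo \<open>M\<close>\<close>

definition unity_root :: "nat \<Rightarrow> complex" where
  "unity_root M = exp (2 * of_real pi * \<i> / of_nat M)"

lemma unity_root_power_eq_1_iff: "M \<ge> 1 \<Longrightarrow> unity_root M ^ t = 1 \<longleftrightarrow> M dvd t"
  using complex_root_unity_eq_1[of M t]
  by (simp add: unity_root_def mult_ac flip: exp_of_nat_mult)

lemma norm_unity_root [simp]: "norm (unity_root M) = 1"
  by (simp add: unity_root_def)

text \<open>Orthogonality of characters: unless \<open>M dvd t\<close>, this is a geometric sum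
  whose ratio differs from 1 but has \<open>M\<close>-th power 1.\<close>

lemma sum_unity_root_powers:
  assumes "M \<ge> 1"
  shows "(\<Sum>r<M. (unity_root M ^ r) ^ t) = of_nat M * of_bool (M dvd t)"
proof (cases "M dvd t")
  case True
  then have "(unity_root M ^ r) ^ t = 1" for r
    using unity_root_power_eq_1_iff[OF assms, of "r * t"] by (simp add: power_mult)
  then show ?thesis using True by simp
next
  case False
  then have "unity_root M ^ t \<noteq> 1" using unity_root_power_eq_1_iff[OF assms] by simp
  moreover have "(unity_root M ^ t) ^ M = 1"
    using unity_root_power_eq_1_iff[OF assms, of "t * M"] by (simp add: power_mult)
  moreover have "(unity_root M ^ r) ^ t = (unity_root M ^ t) ^ r" for r
    by (simp add: mult.commute flip: power_mult)
  ultimately show ?thesis using False by (simp add: geometric_sum)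
qed

text \<open>The divisibility indicator is expanded into \<open>M\<close> characters; by
  \<open>has_mean_twisted_block\<close> only the trivial one, \<open>r = 0\<close>, has a nonzero
  mean. The shift \<open>s\<close> selects the residue class.\<close>

lemma has_mean_residue_block:
  assumes d: "digit_seq b d" "normal_digits b d" and b: "b \<ge> 2" and M: "M \<ge> 1"
    and w: "w \<in> words b k"
  shows "has_mean (\<lambda>i. of_bool (M dvd digit_sum d i + s \<and> block d k i = w))
    (1 / (real M * real b ^ k))"
proof -
  let ?z = "unity_root M"
  let ?f = "\<lambda>r i. (?z ^ r) ^ digit_sum d i * of_bool (block d k i = w)"
  let ?c = "\<lambda>r::nat. if r = 0 then 1 / of_nat b ^ k else 0 :: complex"
  have "has_mean (?f r) (?c r)" if "r < M" for r
  proof (cases "r = 0")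
    case True
    have "has_mean (\<lambda>i. of_bool (block d k i = w))
        ((\<Sum>v\<in>words b k. of_bool (v = w)) / of_nat b ^ k :: complex)"
      by (rule has_mean_block[OF d])
    moreover have "(\<Sum>v\<in>words b k. of_bool (v = w)) = (1::complex)"
      using w by (simp add: of_bool_def finite_words)
    ultimately show ?thesis using True by simp
  next
    case False
    then have "?z ^ r \<noteq> 1"
      using that M by (simp add: unity_root_power_eq_1_iff nat_dvd_not_less)
    then show ?thesis
      using False has_mean_twisted_block[OF d b w] by (simp add: norm_power)
  qed
  then have "has_mean (\<lambda>i. \<Sum>r<M. ((?z ^ r) ^ s / of_nat M) * ?f r i)
      (\<Sum>r<M. ((?z ^ r) ^ s / of_nat M) * ?c r)"
    by (intro has_mean_sum has_mean_cmult) auto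
  moreover have "(\<Sum>r<M. ((?z ^ r) ^ s / of_nat M) * ?c r) = of_real (1 / (real M * real b ^ k))"
    using M by (simp add: if_distrib cong: if_cong)
  moreover have "(\<Sum>r<M. ((?z ^ r) ^ s / of_nat M) * ?f r i)
      = of_real (of_bool (M dvd digit_sum d i + s \<and> block d k i = w))" for i
  proof -
    have "(\<Sum>r<M. ((?z ^ r) ^ s / of_nat M) * ?f r i)
        = (\<Sum>r<M. (?z ^ r) ^ (digit_sum d i + s)) / of_nat M * of_bool (block d k i = w)"
      by (simp add: power_add sum_divide_distrib sum_distrib_right mult_ac)
    also have "\<dots> = of_bool (M dvd digit_sum d i + s \<and> block d k i = w)"
      unfolding sum_unity_root_powers[OF M] using M by simp
    finally show ?thesis by (simp add: of_bool_def)
  qed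
  ultimately show ?thesis by (simp only: has_mean_complex_of_real)
qed

text \<open>Backward reading starts at the end of a block, so the residue is needed there. For a
  fixed word \<open>w\<close> it is the residue before the block with \<open>s\<close> increased by
  \<open>sum_list w\<close>.\<close>

lemma has_mean_residue_after_block:
  assumes d: "digit_seq b d" "normal_digits b d" and b: "b \<ge> 2" and M: "M \<ge> 1"
    and V: "V \<subseteq> words b k"
  shows "has_mean (\<lambda>i. of_bool (M dvd digit_sum d (i + k) + s \<and> block d k i \<in> V))
    (real (card V) / (real M * real b ^ k))"
proof -
  have fin: "finite V" using V finite_words finite_subset by blast
  have "has_mean (\<lambda>i. \<Sum>w\<in>V. of_bool (M dvd digit_sum d i + (sum_list w + s) \<and> block d k i = w))
      (\<Sum>w\<in>V. 1 / (real M * real b ^ k))"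
    using V by (intro has_mean_sum has_mean_residue_block[OF d b M] fin) auto
  moreover have "(\<Sum>w\<in>V. of_bool (M dvd digit_sum d i + (sum_list w + s) \<and> block d k i = w))
      = (of_bool (M dvd digit_sum d (i + k) + s \<and> block d k i \<in> V) :: real)" for i
  proof -
    have "of_bool (M dvd digit_sum d i + (sum_list w + s) \<and> block d k i = w) =
        (if block d k i = w then of_bool (M dvd digit_sum d (i + k) + s) else 0 :: real)" for w
      by (simp add: digit_sum_add add.assoc)
    then show ?thesis using fin by simp
  qed
  ultimately show ?thesis by simp
qed

section \<open>Uniqueness of the normal expansion\<close>

lemma has_mean_of_bool_infinite:
  assumes "has_mean (\<lambda>i. of_bool (P i) :: real) c" "c \<noteq> 0"
  shows "infinite {i. P i}"
proof
  assume fin: "finite {i. P i}"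
  have "(\<lambda>n. (\<Sum>i<n. of_bool (P i) :: real) / of_nat n) \<longlonglongrightarrow> 0"
  proof (rule Lim_null_comparison)
    show "\<forall>\<^sub>F n in sequentially.
        norm ((\<Sum>i<n. of_bool (P i) :: real) / of_nat n) \<le> real (card {i. P i}) / real n"
    proof (rule always_eventually, rule allI)
      fix n
      have "card {i. i < n \<and> P i} \<le> card {i. P i}"
        by (rule card_mono[OF fin]) auto
      then show "norm ((\<Sum>i<n. of_bool (P i) :: real) / of_nat n) \<le> real (card {i. P i}) / real n"
        unfolding card_eq_sum_of_bool[symmetric] by (simp add: divide_right_mono)
    qed
    show "(\<lambda>n. real (card {i. P i}) / real n) \<longlonglongrightarrow> 0"
      by (rule lim_const_over_n)
  qed
  then show False using assms LIMSEQ_unique unfolding has_mean_def by blast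
qed

lemma normal_digit_occurs_infinitely_often:
  assumes "normal_digits b d" "x < b"
  shows "infinite {i. d (Suc i) = x}"
proof -
  have "has_mean (\<lambda>i. of_bool (block d 1 i = [x])) (1 / real b ^ 1)"
    using assms unfolding normal_digits_iff by (auto simp: words_def)
  from has_mean_of_bool_infinite[OF this] assms(2) show ?thesis
    by (simp add: block_def)
qed

text \<open>At the first difference one expansion gains at least \<open>1 / b ^ Suc j\<close>, which is exactly what
  the tail \<open>(b - 1) (b - 1) \<dots>\<close> of the other one can make up for.\<close>

lemma digits_after_first_difference:
  assumes d: "digit_seq b d" and a: "digit_seq b a"
    and eq: "number_of_digits b d = number_of_digits b a" and b: "b \<ge> 2"
    and same: "\<And>i. i < j \<Longrightarrow> d (Suc i) = a (Suc i)" and less: "a (Suc j) < d (Suc j)"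
    and i: "i > j"
  shows "d (Suc i) = 0 \<and> Suc (a (Suc i)) = b"
proof -
  have lt: "d (Suc i) < b" "a (Suc i) < b" for i
    using d a by (auto simp: digit_seq_def)
  have geo: "summable (\<lambda>i. (1 / real b) ^ Suc i)"
    using b by (subst summable_Suc_iff) (auto intro!: summable_geometric)
  have summable: "summable (\<lambda>i. real (e (Suc i)) / real b ^ Suc i)"
    if "digit_seq b e" for e
  proof (rule summable_comparison_test)
    show "summable (\<lambda>i. real b * (1 / real b) ^ Suc i)"
      by (rule summable_mult[OF geo])
    have "e (Suc i) \<le> b" for i using that by (auto simp: digit_seq_def less_imp_le)
    then show "\<exists>N. \<forall>n\<ge>N. norm (real (e (Suc n)) / real b ^ Suc n) \<le> real b * (1 / real b) ^ Suc n"
      by (auto simp: power_one_over divide_right_mono simp del: power_Suc)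
  qed
  define D where "D i = (real (d (Suc i)) - real (a (Suc i))) / real b ^ Suc i" for i
  have sD: "summable D" and D0: "suminf D = 0"
    using summable_diff[OF summable[OF d] summable[OF a]]
      suminf_diff[OF summable[OF d] summable[OF a]] eq
    by (simp_all add: D_def[abs_def] number_of_digits_def diff_divide_distrib)
  \<comment> \<open>\<open>E i\<close> is the most by which digit \<open>Suc i\<close> of
    \<open>a\<close> can outweigh that of \<open>d\<close>; over the tail after \<open>j\<close>
    these sum to \<open>1 / b ^ Suc j\<close>.\<close>
  define E where "E i = (real b - 1) / real b ^ Suc i" for i
  have "(\<lambda>i. (1 / real b) ^ i) sums (1 / (1 - 1 / real b))"
    using b by (intro geometric_sums) simp
  then have s: "(\<lambda>i. (real b - 1) / real b ^ Suc (Suc j) * (1 / real b) ^ i)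
      sums ((real b - 1) / real b ^ Suc (Suc j) * (1 / (1 - 1 / real b)))"
    by (rule sums_mult)
  have E: "(\<lambda>i. E (i + Suc j)) sums (1 / real b ^ Suc j)"
  proof -
    have "1 - 1 / real b = (real b - 1) / real b" using b by (simp add: field_simps)
    then have "(real b - 1) / real b ^ Suc (Suc j) * (1 / (1 - 1 / real b)) = 1 / real b ^ Suc j"
      using b by simp
    moreover have "(real b - 1) / real b ^ Suc (Suc j) * (1 / real b) ^ i = E (i + Suc j)" for i
      by (simp add: E_def power_add power_one_over)
    ultimately show ?thesis using s by simp
  qed
  have "(\<lambda>i. D (i + Suc j)) sums (- D j)"
  proof -
    have "(\<Sum>i<Suc j. D i) = D j" using same by (simp add: D_def)
    then show ?thesis
      using sD D0 suminf_split_initial_segment[OF sD, of "Suc j"]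
        summable_ignore_initial_segment[OF sD, of "Suc j"]
      by (simp add: sums_iff)
  qed
  from sums_add[OF this E]
  have sum: "(\<lambda>i. D (i + Suc j) + E (i + Suc j)) sums (1 / real b ^ Suc j - D j)" by simp
  \<comment> \<open>The tail of \<open>D\<close> sums to \<open>- D j\<close>, so the nonnegative
    terms \<open>D i + E i\<close> after \<open>j\<close> have sum at most 0 and all vanish.\<close>
  have "1 / real b ^ Suc j \<le> D j"
    using less by (simp add: D_def divide_right_mono)
  moreover have nonneg: "0 \<le> D i + E i" for i
    using lt[of i] by (simp add: D_def E_def flip: add_divide_distrib)
  moreover have "(\<Sum>i. D (i + Suc j) + E (i + Suc j)) \<ge> 0"
    by (rule suminf_nonneg[OF sums_summable[OF sum] nonneg])
  ultimately have "(\<Sum>i. D (i + Suc j) + E (i + Suc j)) = 0"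
    using sums_unique[OF sum] by linarith
  then have "\<forall>i. D (i + Suc j) + E (i + Suc j) = 0"
    using sum nonneg by (subst (asm) suminf_eq_zero_iff) (auto simp: sums_iff)
  from this[rule_format, of "i - Suc j"] have "D i + E i = 0" using i by simp
  then have "real (d (Suc i)) - real (a (Suc i)) + (real b - 1) = 0"
    using b by (simp add: D_def E_def flip: add_divide_distrib)
  then show ?thesis using lt[of i] by linarith
qed

text \<open>After a first difference \<open>d\<close> would be constantly 0 or constantly
  \<open>b - 1\<close>, whereas every digit occurs in \<open>d\<close> infinitely often. This
  carries normality from the number over to its given expansion \<open>a\<close>.\<close>

lemma normal_expansion_unique:
  assumes d: "digit_seq b d" "normal_digits b d" and a: "digit_seq b a"
    and eq: "number_of_digits b d = number_of_digits b a" and b: "b \<ge> 2"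
  shows "d (Suc i) = a (Suc i)"
proof (rule ccontr)
  assume "d (Suc i) \<noteq> a (Suc i)"
  define j where "j = (LEAST i. d (Suc i) \<noteq> a (Suc i))"
  have j: "d (Suc j) \<noteq> a (Suc j)"
    unfolding j_def by (rule LeastI) fact
  have same: "d (Suc i) = a (Suc i)" if "i < j" for i
    using not_less_Least that unfolding j_def by blast
  have inf: "\<exists>i>j. d (Suc i) = x" if "x < b" for x
    using normal_digit_occurs_infinitely_often[OF d(2) that] by (simp add: infinite_nat_iff_unbounded)
  show False
  proof (cases "a (Suc j) < d (Suc j)")
    case True
    then show False
      using inf[of 1] digits_after_first_difference[OF d(1) a eq b same True] b by force
  next
    case False
    then have "d (Suc j) < a (Suc j)" using j by simp
    then show False
      using inf[of 0] digits_after_first_difference[OF a d(1) eq[symmetric] b same[symmetric]] b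
      by force
  qed
qed

section \<open>Reading backwards from a selected position\<close>

text \<open>The digits selected when the word \<open>v\<close> is read from the last selected position backwards: the
  state \<open>s\<close> is the prefix sum up to and including the next digit, minus \<open>L\<close>, so whether that digit
  is selected is known before it is read.\<close>

fun select_back :: "int \<Rightarrow> int \<Rightarrow> nat list \<Rightarrow> nat list" where
  "select_back N s [] = []"
| "select_back N s (x # v) = (if N dvd s then [x] else []) @ select_back N (s - int x) v"

lemma select_back_cong: "N dvd s - s' \<Longrightarrow> select_back N s v = select_back N s' v"
proof (induction v arbitrary: s s')
  case (Cons x v)
  have "N dvd s \<longleftrightarrow> N dvd s'"
    using dvd_add_right_iff[OF Cons.prems, of s'] by simp
  moreover have "select_back N (s - int x) v = select_back N (s' - int x) v"
    by (rule Cons.IH) (use Cons.prems in simp)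
  ultimately show ?case by simp
qed simp

text \<open>Induction on \<open>m\<close> for all states and targets. If the next digit is not
  selected, the bounds for its \<open>b\<close> values add up; if it is, only the value
  \<open>hd c\<close> survives, which costs a factor \<open>b\<close>. Equality can fail because a
  word may end before enough digits are selected.\<close>

lemma select_back_prefix_count:
  "(\<Sum>v\<in>words b m. of_bool (take (length c) (select_back N s v) = c)) * b ^ length c \<le> b ^ m"
proof (induction m arbitrary: s c)
  case 0
  then show ?case by (cases c) (simp_all add: words_0)
next
  case (Suc m)
  let ?G = "\<lambda>s c. \<Sum>v\<in>words b m. of_bool (take (length c) (select_back N s v) = c) :: nat"
  show ?case
  proof (cases "c = [] \<or> \<not> N dvd s")
    case False
    then obtain y c' where c: "c = y # c'" and s: "N dvd s" by (cases c) auto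
    have "(\<Sum>v\<in>words b (Suc m). of_bool (take (length c) (select_back N s v) = c))
        = (\<Sum>x<b. if x = y then ?G (s - int x) c' else 0)"
      unfolding sum_words_Suc by (intro sum.cong) (auto simp: c s)
    also have "\<dots> \<le> ?G (s - int y) c'" by simp
    finally have "(\<Sum>v\<in>words b (Suc m). of_bool (take (length c) (select_back N s v) = c)) * b ^ length c
        \<le> ?G (s - int y) c' * b ^ length c' * b"
      by (simp add: c mult_ac)
    also have "\<dots> \<le> b ^ m * b" by (intro mult_right_mono Suc.IH) simp
    finally show ?thesis by (simp add: mult.commute)
  next
    case True
    show ?thesis
    proof (cases "c = []")
      case True
      then show ?thesis by (simp add: card_words)
    next
      case False
      with True have s: "\<not> N dvd s" by simp
      have "(\<Sum>v\<in>words b (Suc m). of_bool (take (length c) (select_back N s v) = c)) * b ^ length c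
          = (\<Sum>x<b. ?G (s - int x) c * b ^ length c)"
        unfolding sum_words_Suc by (simp add: s sum_distrib_right)
      also have "\<dots> \<le> (\<Sum>x<b. b ^ m)" by (intro sum_mono Suc.IH)
      finally show ?thesis by simp
    qed
  qed
qed

lemma card_select_back_prefix:
  "card {v \<in> words b m. take (length c) (select_back N s (rev v)) = c} * b ^ length c \<le> b ^ m"
proof -
  have "card {v \<in> words b m. take (length c) (select_back N s (rev v)) = c}
      = card {v \<in> words b m. take (length c) (select_back N s v) = c}"
    by (rule bij_betw_same_card[where f = rev], rule bij_betwI[where g = rev])
      (auto simp: words_def)
  also have "\<dots> = (\<Sum>v\<in>words b m. of_bool (take (length c) (select_back N s v) = c))"
    using finite_words by (simp add: of_bool_def sum.If_cases Int_def)
  finally show ?thesis using select_back_prefix_count by simp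
qed

lemma mem_selected_iff:
  "n \<in> selected a L N \<longleftrightarrow> n \<ge> 1 \<and> N dvd int (digit_sum a n) - L"
  by (auto simp: selected_def digit_sum_def cong_iff_dvd_diff)

text \<open>A digit appended to the block becomes the head of the reversed word, where the state is
  the prefix sum through that digit minus \<open>L\<close>: exactly the quantity that decides its
  selection.\<close>

lemma select_back_block:
  "select_back N (int (digit_sum a (i + m)) - L) (rev (block a m i))
    = rev (map a (filter (\<lambda>j. j \<in> selected a L N) [Suc i..<Suc (i + m)]))"
proof (induction m)
  case 0
  then show ?case by (simp add: block_def)
next
  case (Suc m)
  have "block a (Suc m) i = block a m i @ [a (Suc (i + m))]"
    by (simp add: block_def)
  then show ?case using Suc by (simp add: mem_selected_iff algebra_simps)
qed

section \<open>Enumeration of an infinite set, gaps, and a counting principle\<close>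

lemma filter_enumerate:
  assumes "infinite T"
  shows "filter (\<lambda>j. j \<in> T) [enumerate T i..<Suc (enumerate T (i + l))]
    = map (enumerate T) [i..<Suc (i + l)]"
proof (induction l)
  case 0
  then show ?case using enumerate_in_set[OF assms] by simp
next
  case (Suc l)
  let ?p = "enumerate T"
  have le: "?p i \<le> ?p (i + l)" "Suc (?p (i + l)) \<le> ?p (i + Suc l)"
    using assms enumerate_step[OF assms, of "i + l"] by (auto simp: Suc_le_eq)
  have "[?p i..<Suc (?p (i + Suc l))]
      = [?p i..<Suc (?p (i + l))] @ [Suc (?p (i + l))..<?p (i + Suc l)] @ [?p (i + Suc l)]"
    using le upt_add_eq_append[of "?p i" "Suc (?p (i + l))" "?p (i + Suc l) - Suc (?p (i + l))"]
    by (simp del: upt_Suc add: upt_Suc_append)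
  moreover have "filter (\<lambda>j. j \<in> T) [Suc (?p (i + l))..<?p (i + Suc l)] = []"
  proof -
    have "j \<notin> T" if "?p (i + l) < j" "j < ?p (Suc (i + l))" for j
    proof
      assume "j \<in> T"
      then obtain n where "j = ?p n" using enumerate_Ex[OF assms] by blast
      then show False using that assms by simp
    qed
    then show ?thesis by (auto simp: filter_empty_conv)
  qed
  ultimately show ?case using Suc enumerate_in_set[OF assms] by simp
qed

text \<open>The count is \<open>Suc K\<close> because \<open>enumerate\<close> starts at 0 and the
  position \<open>enumerate T K\<close> is itself included, through
  \<open>i = enumerate T K - 1\<close>.\<close>

lemma card_enumerate:
  assumes "infinite T" "0 \<notin> T"
  shows "card {i. i < enumerate T K \<and> Suc i \<in> T} = Suc K"
proof -
  have "bij_betw (enumerate T) {..K} (Suc ` {i. i < enumerate T K \<and> Suc i \<in> T})"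
  proof (rule bij_betw_imageI)
    show "inj_on (enumerate T) {..K}"
      using inj_enumerate[OF assms(1)] by (rule inj_on_subset) simp
    show "enumerate T ` {..K} = Suc ` {i. i < enumerate T K \<and> Suc i \<in> T}"
    proof (intro equalityI subsetI)
      fix x assume "x \<in> enumerate T ` {..K}"
      then obtain j where j: "x = enumerate T j" "j \<le> K" by auto
      then have "x \<in> T" "x \<le> enumerate T K" using assms by (auto simp: enumerate_in_set)
      moreover have "x \<noteq> 0" using \<open>x \<in> T\<close> assms by metis
      ultimately show "x \<in> Suc ` {i. i < enumerate T K \<and> Suc i \<in> T}"
        by (cases x) auto
    next
      fix x assume "x \<in> Suc ` {i. i < enumerate T K \<and> Suc i \<in> T}"
      then have x: "x \<in> T" "x \<le> enumerate T K" by auto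
      then obtain j where "x = enumerate T j" using enumerate_Ex[OF assms(1)] by blast
      then show "x \<in> enumerate T ` {..K}" using x assms by simp
    qed
  qed
  from bij_betw_same_card[OF this] show ?thesis by (simp add: card_image)
qed

text \<open>The sum telescopes with stride \<open>k\<close>, leaving \<open>k\<close> values from
  \<open>p K\<close> on minus the first \<open>k\<close> values.\<close>

lemma sum_gaps_le:
  fixes p :: "nat \<Rightarrow> nat"
  assumes "mono p"
  shows "(\<Sum>i<K. p (i + k) - p i) \<le> k * p (K + k)"
proof -
  have "(\<Sum>i<K. p (i + k) - p i) + (\<Sum>i<k. p i) = (\<Sum>i<k. p (K + i))"
  proof (induction K)
    case (Suc K)
    have "(\<Sum>i<k. p (Suc K + i)) + p K = (\<Sum>i<k. p (K + i)) + p (K + k)"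
      by (induction k) simp_all
    moreover have "p K \<le> p (K + k)" using assms by (simp add: monoD)
    ultimately show ?case using Suc by simp
  qed simp
  moreover have "(\<Sum>i<k. p (K + i)) \<le> (\<Sum>i<k. p (K + k))"
    using assms by (intro sum_mono) (simp add: monoD)
  ultimately show ?thesis by simp
qed

text \<open>Markov's inequality for the gaps.\<close>

lemma card_large_gaps:
  fixes p :: "nat \<Rightarrow> nat"
  assumes "mono p"
  shows "m * card {i. i < K \<and> m \<le> p (i + k) - p i} \<le> k * p (K + k)"
proof -
  have "m * card {i. i < K \<and> m \<le> p (i + k) - p i}
      = (\<Sum>i\<in>{i. i < K \<and> m \<le> p (i + k) - p i}. m)" by simp
  also have "\<dots> \<le> (\<Sum>i\<in>{i. i < K \<and> m \<le> p (i + k) - p i}. p (i + k) - p i)"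
    by (intro sum_mono) auto
  also have "\<dots> \<le> (\<Sum>i<K. p (i + k) - p i)" by (intro sum_mono2) auto
  finally show ?thesis using sum_gaps_le[OF assms, of k K] by linarith
qed

lemma tendsto_uniform_if_upper_bounds:
  fixes u :: "'a \<Rightarrow> nat \<Rightarrow> real"
  assumes W: "finite W" "w \<in> W"
    and total: "\<forall>\<^sub>F n in sequentially. (\<Sum>v\<in>W. u v n) = 1"
    and upper: "\<And>v \<delta>. v \<in> W \<Longrightarrow> \<delta> > 0 \<Longrightarrow> \<forall>\<^sub>F n in sequentially. u v n < 1 / real (card W) + \<delta>"
  shows "u w \<longlonglongrightarrow> 1 / real (card W)"
proof (rule tendstoI)
  fix e :: real assume e: "e > 0"
  define C where "C = real (card W)"
  have C: "C \<ge> 1" using W by (simp add: C_def Suc_le_eq card_gt_0_iff) auto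
  \<comment> \<open>The other \<open>C - 1\<close> terms exceed \<open>1 / C\<close> by at most
    \<open>(C - 1) * \<delta> = e - \<delta>\<close> in total, so \<open>u w n\<close> falls short
    of \<open>1 / C\<close> by less than \<open>e\<close>.\<close>
  define \<delta> where "\<delta> = e / C"
  have \<delta>: "\<delta> > 0" "\<delta> \<le> e" using e C by (simp_all add: \<delta>_def divide_le_eq)
  have "\<forall>\<^sub>F n in sequentially. \<forall>v\<in>W. u v n < 1 / C + \<delta>"
    using W(1) upper[OF _ \<delta>(1)] unfolding C_def by (simp add: eventually_ball_finite)
  then show "\<forall>\<^sub>F n in sequentially. dist (u w n) (1 / real (card W)) < e"
    using total
  proof eventually_elim
    case (elim n)
    have "(\<Sum>v\<in>W - {w}. u v n) \<le> (\<Sum>v\<in>W - {w}. 1 / C + \<delta>)"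
      using elim(1) by (intro sum_mono) (auto simp: less_imp_le)
    also have "\<dots> = (C - 1) * (1 / C + \<delta>)"
      using W C by (simp add: C_def card_Diff_singleton of_nat_diff)
    also have "\<dots> = 1 - 1 / C + e - \<delta>"
      using C by (simp add: \<delta>_def field_simps)
    finally have "u w n \<ge> 1 / C - e + \<delta>"
      using elim(2) W by (simp add: sum.remove)
    moreover have "u w n < 1 / C + \<delta>" using elim(1) W by blast
    ultimately show ?case using \<delta> by (simp add: dist_real_def C_def[symmetric] abs_less_iff)
  qed
qed

section \<open>Frequencies in the selected sequence\<close>

lemma filterlim_enumerate_at_top:
  fixes T :: "nat set"
  assumes "infinite T"
  shows "filterlim (enumerate T) at_top sequentially"
  by (rule filterlim_subseq) (use assms in \<open>simp add: strict_mono_def\<close>)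

context
  fixes b M :: nat and a :: "nat \<Rightarrow> nat" and L :: int
  assumes digits: "digit_seq b a" and normal: "normal_digits b a"
    and b: "b \<ge> 2" and M: "M \<ge> 1"
begin

private abbreviation "T \<equiv> selected a L (int M)"
private abbreviation "p \<equiv> enumerate T"

text \<open>Replaces \<open>- L\<close> by its nonnegative representative, since the shift in the
  residue lemmas is a natural number.\<close>

lemma mem_selected_iff_dvd: "Suc n \<in> T \<longleftrightarrow> M dvd digit_sum a (Suc n) + nat (- L mod int M)"
proof -
  have "int (digit_sum a (Suc n) + nat (- L mod int M)) = int (digit_sum a (Suc n)) + (- L mod int M)"
    using M by simp
  moreover have "int M dvd int (digit_sum a (Suc n)) + (- L mod int M)
      \<longleftrightarrow> int M dvd int (digit_sum a (Suc n)) + - L"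
    unfolding dvd_eq_mod_eq_0 mod_add_right_eq ..
  ultimately have "int M dvd int (digit_sum a (Suc n) + nat (- L mod int M))
      \<longleftrightarrow> int M dvd int (digit_sum a (Suc n)) - L"
    by simp
  then show ?thesis by (simp only: mem_selected_iff of_nat_dvd_iff) simp
qed

lemma has_mean_selected: "has_mean (\<lambda>i. of_bool (Suc i \<in> T)) (1 / real M)"
proof -
  \<comment> \<open>With the empty word the joint statement reduces to residues of prefix sums
    alone.\<close>
  have "has_mean (\<lambda>i. of_bool (M dvd digit_sum a i + nat (- L mod int M) \<and> block a 0 i = []))
      (1 / (real M * real b ^ 0))"
    by (rule has_mean_residue_block[OF digits normal b M]) (simp add: words_0)
  then have "has_mean (\<lambda>i. of_bool (M dvd digit_sum a i + nat (- L mod int M))) (1 / real M)"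
    by (simp add: block_def)
  from has_mean_shift[OF this, of 1 1] show ?thesis
    by (simp only: mem_selected_iff_dvd add_Suc_right add_0_right One_nat_def) simp
qed

lemma infinite_selected: "infinite T"
proof -
  have "infinite {i. Suc i \<in> T}"
    by (rule has_mean_of_bool_infinite[OF has_mean_selected]) (use M in simp)
  moreover have "{i. Suc i \<in> T} = Suc -` T" by auto
  ultimately show ?thesis using finite_vimageI[of T Suc] by auto
qed

lemma mono_selected: "mono p"
  using infinite_selected by (simp add: mono_def)

text \<open>The density \<open>1 / M\<close> of \<open>T\<close> is evaluated along
  \<open>n = p K\<close>, where the count is \<open>K + 1\<close>, and inverted; a fixed shift
  \<open>k\<close> does not change the limit.\<close>

lemma selected_asymp: "(\<lambda>K. real (p (K + k)) / real K) \<longlonglongrightarrow> real M"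
proof -
  have "(\<lambda>K. (\<Sum>i<p K. of_bool (Suc i \<in> T)) / real (p K)) \<longlonglongrightarrow> 1 / real M"
    using filterlim_compose[OF has_mean_selected[unfolded has_mean_def]
      filterlim_enumerate_at_top[OF infinite_selected]] .
  moreover have "(\<Sum>i<p K. of_bool (Suc i \<in> T)) = real (Suc K)" for K
    using card_enumerate[OF infinite_selected, of K]
    by (simp add: mem_selected_iff flip: card_eq_sum_of_bool)
  ultimately have "(\<lambda>K. real (Suc K) / real (p K)) \<longlonglongrightarrow> 1 / real M" by simp
  then have "(\<lambda>K. inverse (real (Suc K) / real (p K))) \<longlonglongrightarrow> inverse (1 / real M)"
    by (rule tendsto_inverse) (use M in simp)
  then have "(\<lambda>K. real (p K) / real (Suc K)) \<longlonglongrightarrow> real M" by simp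
  then have "(\<lambda>K. real (p (K + k)) / real (Suc (K + k))) \<longlonglongrightarrow> real M"
    by (rule LIMSEQ_ignore_initial_segment)
  moreover have "(\<lambda>K. real (Suc (K + k)) / real K) \<longlonglongrightarrow> 1"
  proof -
    have "(\<lambda>K. 1 + real (Suc k) / real K) \<longlonglongrightarrow> 1 + 0"
      by (intro tendsto_add tendsto_const lim_const_over_n)
    moreover have "\<forall>\<^sub>F K in sequentially. 1 + real (Suc k) / real K = real (Suc (K + k)) / real K"
      using eventually_gt_at_top[of 0] by eventually_elim (simp add: field_simps)
    ultimately show ?thesis using tendsto_cong by force
  qed
  ultimately have "(\<lambda>K. real (p (K + k)) / real (Suc (K + k)) * (real (Suc (K + k)) / real K))
      \<longlonglongrightarrow> real M * 1"
    by (rule tendsto_mult)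
  then show ?thesis by simp
qed

text \<open>The window of length \<open>m\<close> ending at \<open>p (i + k - 1)\<close> reaches
  back beyond \<open>p i\<close>, so its last \<open>k\<close> selected digits are the wanted ones.
  The starting state is 0 because the prefix sum at a selected position is congruent to
  \<open>L\<close>.\<close>

lemma select_back_at_selected:
  assumes k: "k \<ge> 1" and m: "m \<le> p (i + k - 1)" and gap: "p (i + k - 1) - p i < m"
  shows "take k (select_back (int M) 0 (rev (block a m (p (i + k - 1) - m))))
    = rev (map (\<lambda>j. a (p j)) [i..<i + k])"
proof -
  obtain l where l: "k = Suc l" using k by (cases k) auto
  define n where "n = p (i + l) - m"
  have n: "n + m = p (i + l)" "Suc n \<le> p i" and le: "p i \<le> p (i + l)"
    using m gap infinite_selected by (auto simp: n_def l)
  have sel: "p (i + l) \<in> T" by (rule enumerate_in_set[OF infinite_selected])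
  have "select_back (int M) 0 (rev (block a m n))
      = select_back (int M) (int (digit_sum a (n + m)) - L) (rev (block a m n))"
    by (rule select_back_cong[symmetric]) (use sel n in \<open>simp add: mem_selected_iff\<close>)
  also have "\<dots> = rev (map a (filter (\<lambda>j. j \<in> T) [Suc n..<Suc (p (i + l))]))"
    by (simp only: select_back_block flip: n(1))
  also have "[Suc n..<Suc (p (i + l))] = [Suc n..<p i] @ [p i..<Suc (p (i + l))]"
    using n le upt_add_eq_append[of "Suc n" "p i" "Suc (p (i + l)) - p i"] by (simp del: upt_Suc)
  also have "filter (\<lambda>j. j \<in> T) \<dots> = filter (\<lambda>j. j \<in> T) [Suc n..<p i] @ map p [i..<Suc (i + l)]"
    unfolding filter_append filter_enumerate[OF infinite_selected] ..
  finally show ?thesis by (simp add: l n_def o_def del: upt_Suc)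
qed

text \<open>An occurrence has \<open>i < m\<close>, or stretches over a large gap, or is seen in
  full by the window of length \<open>m\<close> ending at its last digit. Occurrences of the last
  kind inject into the starts of such windows.\<close>

lemma count_selected_occurrences:
  assumes c: "c \<in> words b k" and k: "k \<ge> 1"
  defines "V \<equiv> \<lambda>m. {v \<in> words b m. take k (select_back (int M) 0 (rev v)) = rev c}"
  shows "card {i. i < K \<and> map (\<lambda>j. a (p j)) [i..<i + k] = c}
    \<le> m + card {i. i < K \<and> m \<le> p (i + k) - p i}
      + card {i. i < p (K + k) \<and> M dvd digit_sum a (i + m) + nat (- L mod int M) \<and> block a m i \<in> V m}"
    (is "card ?O \<le> m + card ?B + card ?Q")
proof -
  let ?e = "\<lambda>i. p (i + k - 1)"
  \<comment> \<open>\<open>m \<le> i\<close> keeps the window inside the expansion, since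
    \<open>i \<le> p (i + k - 1)\<close>. The gap runs one selected position past the occurrence,
    which only strengthens the condition.\<close>
  define G where "G = {i \<in> ?O. m \<le> i \<and> p (i + k) - p i < m}"
  have e_le: "?e i \<le> p (i + k)" for i using infinite_selected by simp
  have m_le: "m \<le> ?e i" if "i \<in> G" for i
  proof -
    have "m \<le> i" using that by (simp add: G_def)
    then have "m \<le> i + k - 1" using k by linarith
    then show ?thesis using le_enumerate[OF infinite_selected, of "i + k - 1"] by (rule le_trans)
  qed
  have "inj_on (\<lambda>i. ?e i - m) G"
  proof (rule inj_onI)
    fix i j assume "i \<in> G" "j \<in> G" "?e i - m = ?e j - m"
    then have "?e i = ?e j" using m_le by (metis le_add_diff_inverse)
    then have "i + k - 1 = j + k - 1"
      using inj_enumerate[OF infinite_selected] by (simp add: inj_eq)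
    then show "i = j" using k by simp
  qed
  moreover have "(\<lambda>i. ?e i - m) ` G \<subseteq> ?Q"
  proof
    fix n assume "n \<in> (\<lambda>i. ?e i - m) ` G"
    then obtain i where i: "i \<in> G" and n: "n = ?e i - m" by auto
    have nm: "n + m = ?e i" using m_le[OF i] n by simp
    have "i < K" using i by (simp add: G_def)
    then have "i + k - 1 < K + k" by linarith
    then have "?e i < p (K + k)" using infinite_selected by simp
    then have "n < p (K + k)" using n by simp
    moreover have "M dvd digit_sum a (n + m) + nat (- L mod int M)"
    proof -
      have "?e i \<in> T" by (rule enumerate_in_set[OF infinite_selected])
      moreover from this have "?e i \<ge> 1" by (simp add: mem_selected_iff)
      then obtain l where "?e i = Suc l" by (cases "?e i") auto
      ultimately show ?thesis unfolding nm by (metis mem_selected_iff_dvd)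
    qed
    moreover have "block a m n \<in> V m"
    proof -
      have "p (i + k - 1) - p i < m" using i e_le[of i] by (auto simp: G_def)
      then have "take k (select_back (int M) 0 (rev (block a m n))) = rev c"
        using select_back_at_selected[OF k m_le[OF i]] i unfolding n by (simp add: G_def)
      then show ?thesis using block_in_words[OF digits] by (simp add: V_def)
    qed
    ultimately show "n \<in> ?Q" by simp
  qed
  ultimately have G: "card G \<le> card ?Q" by (intro card_inj_on_le) auto
  have "?O \<subseteq> {..<m} \<union> ?B \<union> G" by (auto simp: G_def)
  moreover have "finite ({..<m} \<union> ?B \<union> G)" by (auto simp: G_def)
  ultimately have "card ?O \<le> card ({..<m} \<union> ?B \<union> G)" by (rule card_mono[rotated])
  also have "\<dots> \<le> card {..<m} + card ?B + card G"
    by (meson add_right_mono card_Un_le order_trans)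
  finally show ?thesis using G by simp
qed

lemma selected_frequency_upper:
  assumes c: "c \<in> words b k" and k: "k \<ge> 1" and \<delta>: "\<delta> > 0"
  shows "\<forall>\<^sub>F K in sequentially.
    real (card {i. i < K \<and> map (\<lambda>j. a (p j)) [i..<i + k] = c}) / real K < 1 / real b ^ k + \<delta>"
proof -
  \<comment> \<open>The large gaps have upper frequency at most \<open>k * M / m\<close>, here less
    than \<open>\<delta>\<close>.\<close>
  obtain m :: nat where m: "real k * real M / \<delta> < real m" using reals_Archimedean2 by blast
  have "m > 0" using m \<delta> by (cases "m = 0") (auto simp: field_simps mult_less_0_iff)
  define V where "V = {v \<in> words b m. take k (select_back (int M) 0 (rev v)) = rev c}"
  define \<mu> where "\<mu> = real (card V) / (real M * real b ^ m)"
  \<comment> \<open>\<open>\<mu>\<close> is a density per position and there are about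
    \<open>M\<close> positions per selected digit; the backward count bounds
    \<open>card V / b ^ m\<close> by \<open>1 / b ^ k\<close>.\<close>
  have \<mu>: "\<mu> * real M \<le> 1 / real b ^ k"
  proof -
    have "card V * b ^ k \<le> b ^ m"
      using card_select_back_prefix[of b m "rev c" "int M" 0] c by (simp add: V_def words_def)
    then have "real (card V) * real b ^ k \<le> real b ^ m"
      by (metis of_nat_le_iff of_nat_mult of_nat_power)
    then show ?thesis using b M by (simp add: \<mu>_def field_simps)
  qed
  define q where "q i \<longleftrightarrow> M dvd digit_sum a (i + m) + nat (- L mod int M) \<and> block a m i \<in> V" for i
  have "has_mean (\<lambda>i. of_bool (q i)) \<mu>"
    unfolding q_def \<mu>_def by (rule has_mean_residue_after_block[OF digits normal b M]) (auto simp: V_def)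
  moreover have pk: "filterlim (\<lambda>K. p (K + k)) at_top sequentially"
    by (rule filterlim_compose[OF filterlim_enumerate_at_top[OF infinite_selected]])
      (rule filterlim_add_const_nat_at_top)
  ultimately have "(\<lambda>K. (\<Sum>i<p (K + k). of_bool (q i)) / real (p (K + k))) \<longlonglongrightarrow> \<mu>"
    unfolding has_mean_def by (rule filterlim_compose)
  \<comment> \<open>Changes the normalization from positions read to selected digits.\<close>
  then have "(\<lambda>K. (\<Sum>i<p (K + k). of_bool (q i)) / real (p (K + k)) * (real (p (K + k)) / real K))
      \<longlonglongrightarrow> \<mu> * real M"
    by (rule tendsto_mult[OF _ selected_asymp])
  moreover have "\<forall>\<^sub>F K in sequentially.
      (\<Sum>i<p (K + k). of_bool (q i)) / real (p (K + k)) * (real (p (K + k)) / real K)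
      = real (card {i. i < p (K + k) \<and> q i}) / real K"
    using eventually_compose_filterlim[OF eventually_gt_at_top[of 0] pk]
    by eventually_elim (simp only: card_eq_sum_of_bool, simp)
  ultimately have lim: "(\<lambda>K. real (card {i. i < p (K + k) \<and> q i}) / real K) \<longlonglongrightarrow> \<mu> * real M"
    by (rule Lim_transform_eventually)
  let ?u = "\<lambda>K. real m / real K + real k / real m * (real (p (K + k)) / real K)
      + real (card {i. i < p (K + k) \<and> q i}) / real K"
  have "?u \<longlonglongrightarrow> 0 + real k / real m * real M + \<mu> * real M"
    by (intro tendsto_add lim_const_over_n tendsto_mult_left selected_asymp lim)
  moreover have "0 + real k / real m * real M + \<mu> * real M < 1 / real b ^ k + \<delta>"
  proof -
    have "real k / real m * real M < \<delta>" using m \<open>m > 0\<close> \<delta> by (simp add: field_simps)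
    then show ?thesis using \<mu> by linarith
  qed
  ultimately have "\<forall>\<^sub>F K in sequentially. ?u K < 1 / real b ^ k + \<delta>" by (rule order_tendstoD(2))
  then show ?thesis
  proof eventually_elim
    case (elim K)
    have "real (card {i. i < K \<and> m \<le> p (i + k) - p i}) \<le> real k / real m * real (p (K + k))"
    proof -
      have "m * card {i. i < K \<and> m \<le> p (i + k) - p i} \<le> k * p (K + k)"
        by (rule card_large_gaps[OF mono_selected])
      then have "real m * real (card {i. i < K \<and> m \<le> p (i + k) - p i}) \<le> real k * real (p (K + k))"
        unfolding of_nat_mult[symmetric] of_nat_le_iff .
      then show ?thesis using \<open>m > 0\<close> by (simp add: field_simps)
    qed
    moreover have "real (card {i. i < K \<and> map (\<lambda>j. a (p j)) [i..<i + k] = c})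
        \<le> real m + real (card {i. i < K \<and> m \<le> p (i + k) - p i}) + real (card {i. i < p (K + k) \<and> q i})"
      using count_selected_occurrences[OF c k, of K m]
      unfolding q_def V_def of_nat_add[symmetric] of_nat_le_iff .
    ultimately have "real (card {i. i < K \<and> map (\<lambda>j. a (p j)) [i..<i + k] = c})
        \<le> real m + real k / real m * real (p (K + k)) + real (card {i. i < p (K + k) \<and> q i})"
      by linarith
    then have "real (card {i. i < K \<and> map (\<lambda>j. a (p j)) [i..<i + k] = c}) / real K
        \<le> (real m + real k / real m * real (p (K + k)) + real (card {i. i < p (K + k) \<and> q i})) / real K"
      by (rule divide_right_mono) simp
    then show ?case using elim by (simp add: add_divide_distrib)
  qed
qed

lemma digit_seq_selected: "digit_seq b (\<lambda>i. a (selected_index a L (int M) i))"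
  using digits enumerate_in_set[OF infinite_selected]
  by (auto simp: digit_seq_def selected_index_def mem_selected_iff)

lemma normal_digits_selected: "normal_digits b (\<lambda>i. a (selected_index a L (int M) i))"
  unfolding normal_digits_iff
proof (intro allI impI ballI)
  let ?d = "\<lambda>i. a (selected_index a L (int M) i)"
  fix k w assume k: "k \<ge> (1::nat)" and w: "w \<in> words b k"
  \<comment> \<open>\<open>selected_index\<close> counts from 1 and \<open>enumerate\<close> from 0,
    so the digits at \<open>i + 1\<close>, ..., \<open>i + k\<close> sit at \<open>p i\<close>, ...,
    \<open>p (i + k - 1)\<close>.\<close>
  have block: "block ?d k i = map (\<lambda>j. a (p j)) [i..<i + k]" for i
    by (rule nth_equalityI) (auto simp: block_def selected_index_def simp del: upt_Suc)
  let ?u = "\<lambda>v n. (\<Sum>i<n. of_bool (block ?d k i = v)) / real n"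
  have "?u w \<longlonglongrightarrow> 1 / real (card (words b k))"
  proof (rule tendsto_uniform_if_upper_bounds[OF finite_words w])
    show "\<forall>\<^sub>F n in sequentially. (\<Sum>v\<in>words b k. ?u v n) = 1"
      using eventually_gt_at_top[of 0]
    proof eventually_elim
      case (elim n)
      have "(\<Sum>v\<in>words b k. of_bool (block ?d k i = v)) = (1::real)" for i
        using block_in_words[OF digit_seq_selected, of k i] by (simp add: of_bool_def finite_words)
      then have "(\<Sum>i<n. \<Sum>v\<in>words b k. of_bool (block ?d k i = v)) = real n" by simp
      then show ?case
        using elim by (subst (asm) sum.swap) (simp flip: sum_divide_distrib)
    qed
    show "\<forall>\<^sub>F n in sequentially. ?u v n < 1 / real (card (words b k)) + \<delta>"
      if "v \<in> words b k" "\<delta> > 0" for v \<delta>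
      using selected_frequency_upper[OF that(1) k that(2)]
      by (simp only: block card_eq_sum_of_bool card_words of_nat_power)
  qed
  then show "has_mean (\<lambda>i. of_bool (block ?d k i = w)) (1 / real b ^ k)"
    by (simp only: has_mean_def card_words of_nat_power)
qed

end

theorem theorem1p3:
  fixes b :: nat and a :: "nat \<Rightarrow> nat" and x :: real and L N :: int
  assumes "b \<ge> 2"
    and "digit_seq b a"
    and "x = number_of_digits b a"
    and "normal_to_base b x"
    and "N \<ge> 2"
  shows "infinite (selected a L N) \<and>
    normal_to_base b (number_of_digits b (\<lambda>i. a (selected_index a L N i)))"
proof -
  \<comment> \<open>Normality of \<open>x\<close> only provides some normal expansion
    \<open>d\<close>; uniqueness identifies it with \<open>a\<close> at all indices from 1 on, the
    only ones that blocks read.\<close>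
  obtain d where d: "digit_seq b d" "normal_digits b d" "number_of_digits b d = number_of_digits b a"
    using assms(3,4) by (auto simp: normal_to_base_def)
  have "d (Suc i) = a (Suc i)" for i
    by (rule normal_expansion_unique[OF d(1,2) assms(2) d(3) assms(1)])
  then have "block d k i = block a k i" for k i
    by (rule_tac nth_equalityI) (auto simp: block_def simp del: upt_Suc)
  then have normal: "normal_digits b a"
    using d(2) by (simp add: normal_digits_iff)
  define M where "M = nat N"
  have M: "M \<ge> 1" "N = int M" using assms(5) by (auto simp: M_def)
  show ?thesis
    unfolding normal_to_base_def M(2)
    using infinite_selected[OF assms(2) normal assms(1) M(1)]
      digit_seq_selected[OF assms(2) normal assms(1) M(1)]
      normal_digits_selected[OF assms(2) normal assms(1) M(1)]
    by blast
qed

end
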